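(* Asymptotically almost surely, the NLC-width of a graph drawn randomly from $G(n,\frac12)$ is $\Theta(n)$. That is, there exist constants $0<c\le C$ such that, for $G$ drawn from $G(n,\frac12)$, $$\lim_{n\to\infty}\Pr\big[c\,n\le \mathrm{nlc}(G)\le C\,n\big]=1,$$ where $\mathrm{nlc}(G)$ denotes the NLC-width of $G$.
   Context: $G(n,\frac12)$ is the random simple graph on $n$ labelled vertices in which each of the $\binom n2$ possible edges appears independently with probability $\frac12$. NLC-width is the standard notion: $\mathrm{nlc}(G)$ is the minimum $k$ such that $G$, with some labelling of its vertices by labels in $\{1,\dots,k\}$, can be built using the operations: (i) create a single vertex with a label in $\{1,\dots,k\}$; (ii) for a set $S\subseteq\{1,\dots,k\}^2$ and two vertex-disjoint labelled graphs $H_1,H_2$, form their disjoint union and add every edge $uv$ with $u\in V(H_1)$, $v\in V(H_2)$ and (label of $u$, label of $v$) $\in S$, keeping all labels; (iii) for a map $R:\{1,\dots,k\}\to\{1,\dots,k\}$, replace every label $i$ by $R(i)$. *)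

theory Defs
  imports "HOL-Probability.Probability" "HOL-Probability.Product_PMF" "HOL-Library.Ramsey"
begin

text \<open>
  A finite simple graph is given by its vertex set \<open>V\<close> and its edge set \<open>E\<close>, a set of two-element
  subsets of \<open>V\<close>, that is \<open>E \<subseteq> [V]\<^bsup>2\<^esup>\<close>, written \<open>nsets V 2\<close>.
\<close>

definition random_graph :: "nat \<Rightarrow> real \<Rightarrow> nat set set pmf" where
  "random_graph n p =
     map_pmf (\<lambda>f. {e \<in> nsets {..<n} 2. f e})
       (Pi_pmf (nsets {..<n} 2) False (\<lambda>_. bernoulli_pmf p))"

text \<open>
  \<open>nlc_built k V E lab\<close>: the graph \<open>(V, E)\<close>, its vertices labelled by \<open>lab\<close>, can be built by the
  NLC operations with labels in \<open>{1..k}\<close>. Only the values of \<open>lab\<close> on \<open>V\<close> are meaningful; the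
  values elsewhere never influence the constructed graph.
\<close>

inductive nlc_built :: "nat \<Rightarrow> 'a set \<Rightarrow> 'a set set \<Rightarrow> ('a \<Rightarrow> nat) \<Rightarrow> bool" for k where
  vertex: "lab v \<in> {1..k} \<Longrightarrow> nlc_built k {v} {} lab"
| join: "\<lbrakk>nlc_built k V1 E1 lab1; nlc_built k V2 E2 lab2; V1 \<inter> V2 = {};
          S \<subseteq> {1..k} \<times> {1..k}\<rbrakk> \<Longrightarrow>
         nlc_built k (V1 \<union> V2)
           (E1 \<union> E2 \<union> {{u, v} | u v. u \<in> V1 \<and> v \<in> V2 \<and> (lab1 u, lab2 v) \<in> S})
           (\<lambda>w. if w \<in> V1 then lab1 w else lab2 w)"
| relabel: "\<lbrakk>nlc_built k V E lab; R \<in> {1..k} \<rightarrow> {1..k}\<rbrakk> \<Longrightarrow>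
            nlc_built k V E (R \<circ> lab)"

text \<open>
  The operations produce exactly the nonempty finite simple graphs, so the width below is
  unspecified on the graph without vertices.
\<close>

definition nlc_width :: "'a set \<Rightarrow> 'a set set \<Rightarrow> nat" where
  "nlc_width V E = (LEAST k. \<exists>lab. nlc_built k V E lab)"

end

theory Submission
  imports Defs "HOL-Real_Asymp.Real_Asymp"
begin

text \<open>
  The upper bound is deterministic: if all vertices keep pairwise distinct labels, then the
  vertices can be attached one at a time, each by a join that prescribes its neighbours
  individually, so a graph with \<open>n\<close> vertices has NLC-width at most \<open>n\<close>.

  For the lower bound, walk down an NLC expression of width \<open>k\<close> from the root to the larger
  operand until the current subgraph has fewer than \<open>2m\<close> vertices; it still has at least \<open>m\<close>. Its
  vertex set \<open>A\<close> carries at most \<open>k\<close> labels, and equally labelled vertices are treated alike by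
  all later operations, so \<open>A\<close> falls into at most \<open>k\<close> classes of vertices with the same
  neighbours outside \<open>A\<close> (\<open>nlc_built_balanced_cut\<close>).

  Such a cut is very unlikely. Once \<open>A\<close> and the classes are fixed, the neighbours outside \<open>A\<close> of
  one representative per class determine those of the other at least \<open>card A - k\<close> vertices, which
  costs a factor \<open>2\<close> for each of \<open>(card A - k) * (n - card A)\<close> pairs (\<open>card_twin_cut_graphs\<close>).
  With \<open>m = n div 3\<close> and \<open>k \<le> n / 12\<close> the exponent is at least \<open>n\<^sup>2 / 72\<close>, which outweighs the at
  most \<open>2 ^ n * n ^ n\<close> choices of \<open>A\<close> and its classes.
\<close>

section \<open>Linear upper bound\<close>

lemma nlc_built_injective_labels:
  assumes "finite V" "V \<noteq> {}" "E \<subseteq> nsets V 2" "inj_on lab V" "lab ` V \<subseteq> {1..k}"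
  shows "nlc_built k V E lab"
  using assms
proof (induction V arbitrary: E rule: finite_ne_induct)
  case (singleton v)
  then have "E = {}"
    by (auto simp: nsets_def subset_singleton_iff)
  with singleton show ?case
    by (auto intro: nlc_built.vertex)
next
  case (insert v V)
  let ?E' = "E \<inter> nsets V 2" and ?S = "{(lab u, lab v) |u. u \<in> V \<and> {u, v} \<in> E}"
  have 1: "nlc_built k V ?E' lab"
    using insert by (intro insert.IH) auto
  have 2: "nlc_built k {v} {} lab"
    using insert by (intro nlc_built.vertex) auto
  have 3: "nlc_built k (V \<union> {v})
      (?E' \<union> {} \<union> {{x, y} |x y. x \<in> V \<and> y \<in> {v} \<and> (lab x, lab y) \<in> ?S})
      (\<lambda>w. if w \<in> V then lab w else lab w)"
    using insert.hyps insert.prems by (intro nlc_built.join[OF 1 2]) auto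
  have "{{x, y} |x y. x \<in> V \<and> y \<in> {v} \<and> (lab x, lab y) \<in> ?S} = {{u, v} |u. u \<in> V \<and> {u, v} \<in> E}"
    using insert.prems(2) by (auto simp: inj_on_def)
  moreover have "E = ?E' \<union> {{u, v} |u. u \<in> V \<and> {u, v} \<in> E}"
  proof -
    have "e \<in> ?E' \<union> {{u, v} |u. u \<in> V \<and> {u, v} \<in> E}" if e: "e \<in> E" for e
    proof -
      obtain x y where "e = {x, y}" "x \<in> insert v V" "y \<in> insert v V" "x \<noteq> y"
        using subsetD[OF insert.prems(1) e] by (auto simp: nsets_2_eq)
      with e show ?thesis
        by (auto simp: insert_commute)
    qed
    then show ?thesis by auto
  qed
  ultimately show ?case
    using 3 by simp
qed

lemma nlc_width_le:
  assumes "n > 0" "E \<subseteq> nsets {..<n} 2"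
  shows "nlc_width {..<n} E \<le> n"
    and "\<exists>lab. nlc_built (nlc_width {..<n} E) {..<n} E lab"
proof -
  have *: "\<exists>lab. nlc_built n {..<n} E lab"
    using assms by (intro exI[of _ Suc] nlc_built_injective_labels) auto
  show "nlc_width {..<n} E \<le> n"
    unfolding nlc_width_def using * by (rule Least_le)
  show "\<exists>lab. nlc_built (nlc_width {..<n} E) {..<n} E lab"
    unfolding nlc_width_def using * by (rule LeastI)
qed

section \<open>Balanced cuts in graphs of small width\<close>

text \<open>
  Vertices of \<open>A\<close> with equal \<open>f\<close>-values are twins as seen from outside \<open>A\<close>. The number of
  values of \<open>f\<close> thus bounds the number of distinct rows in the adjacency matrix between \<open>A\<close> and
  \<open>V - A\<close>.
\<close>

definition twin_cut :: "'a set \<Rightarrow> 'a set set \<Rightarrow> 'a set \<Rightarrow> ('a \<Rightarrow> 'b) \<Rightarrow> bool" where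
  "twin_cut V E A f \<longleftrightarrow>
     (\<forall>u\<in>A. \<forall>u'\<in>A. f u = f u' \<longrightarrow> (\<forall>v\<in>V - A. {u, v} \<in> E \<longleftrightarrow> {u', v} \<in> E))"

lemma nlc_built_wellformed:
  assumes "nlc_built k V E lab"
  shows "finite V \<and> E \<subseteq> nsets V 2 \<and> lab ` V \<subseteq> {1..k}"
  using assms
proof induction
  case (join V1 E1 lab1 V2 E2 lab2 S)
  then have "{{u, v} |u v. u \<in> V1 \<and> v \<in> V2 \<and> (lab1 u, lab2 v) \<in> S} \<subseteq> nsets (V1 \<union> V2) 2"
    by auto
  moreover have "nsets V1 2 \<subseteq> nsets (V1 \<union> V2) 2" "nsets V2 2 \<subseteq> nsets (V1 \<union> V2) 2"
    by (simp_all add: nsets_mono)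
  ultimately show ?case
    using join.IH by (intro conjI Un_least) auto
qed auto

text \<open>
  A twin cut of one operand of a join survives the join because edges to the other operand depend
  only on the labels that the operand has at that moment. This is why the cut labelling \<open>f\<close> has to
  be at least as fine as the current labelling. The edges added by the join enter through \<open>F\<close>
  and an abstract \<open>Q\<close>, so that the cut may sit in either operand.
\<close>

lemma twin_cut_join:
  assumes "V1 \<inter> V2 = {}" "E1 \<subseteq> nsets V1 2" "E2 \<subseteq> nsets V2 2" "A \<subseteq> V1"
    and "twin_cut V1 E1 A f" "\<And>u u'. \<lbrakk>u \<in> A; u' \<in> A; f u = f u'\<rbrakk> \<Longrightarrow> lab u = lab u'"
    and cross: "\<And>u v. \<lbrakk>u \<in> V1; v \<in> V2\<rbrakk> \<Longrightarrow> {u, v} \<in> F \<longleftrightarrow> Q (lab u) v"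
      "\<And>u v. \<lbrakk>u \<in> V1; v \<in> V1\<rbrakk> \<Longrightarrow> {u, v} \<notin> F"
  shows "twin_cut (V1 \<union> V2) (E1 \<union> E2 \<union> F) A f"
  unfolding twin_cut_def
proof (intro ballI impI)
  fix u u' v
  assume *: "u \<in> A" "u' \<in> A" "f u = f u'" "v \<in> V1 \<union> V2 - A"
  have V1: "u \<in> V1" "u' \<in> V1"
    using * assms(4) by auto
  have E2: "{x, v} \<notin> E2" if "x \<in> V1" for x
    using that assms(1,3) doubleton_in_nsets_2[of x v V2] by blast
  show "{u, v} \<in> E1 \<union> E2 \<union> F \<longleftrightarrow> {u', v} \<in> E1 \<union> E2 \<union> F"
  proof (cases "v \<in> V1")
    case True
    then have "{x, v} \<in> E1 \<union> E2 \<union> F \<longleftrightarrow> {x, v} \<in> E1" if "x \<in> V1" for x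
      using that E2 cross(2) by blast
    moreover have "{u, v} \<in> E1 \<longleftrightarrow> {u', v} \<in> E1"
      using * True assms(5) unfolding twin_cut_def by blast
    ultimately show ?thesis
      using V1 by blast
  next
    case False
    then have v: "v \<in> V2"
      using * by blast
    have "{x, v} \<notin> E1" for x
      using False assms(2) doubleton_in_nsets_2[of x v V1] by blast
    then have "{x, v} \<in> E1 \<union> E2 \<union> F \<longleftrightarrow> Q (lab x) v" if "x \<in> V1" for x
      using that E2 cross(1)[OF that v] by blast
    moreover have "lab u = lab u'"
      using * assms(6) by blast
    ultimately show ?thesis
      using V1 by metis
  qed
qed

text \<open>
  If \<open>V\<close> has fewer than \<open>2 * m\<close> vertices, the whole of \<open>V\<close> with its current labels is a cut. A join
  with at least \<open>2 * m\<close> vertices has an operand with at least \<open>m\<close>, whose cut survives by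
  \<open>twin_cut_join\<close>. Relabelling only merges labels, so \<open>f\<close> stays finer than \<open>lab\<close>.
\<close>

lemma nlc_built_balanced_cut_refining:
  assumes "nlc_built k V E lab" "0 < m" "m \<le> card V"
  shows "\<exists>A f. A \<subseteq> V \<and> m \<le> card A \<and> card A < 2 * m \<and> f ` A \<subseteq> {1..k} \<and>
    (\<forall>u\<in>A. \<forall>u'\<in>A. f u = f u' \<longrightarrow> lab u = lab u') \<and> twin_cut V E A f"
  using assms
proof induction
  case (vertex lab v)
  then show ?case
    by (intro exI[of _ "{v}"] exI[of _ lab]) (auto simp: twin_cut_def)
next
  case (join V1 E1 lab1 V2 E2 lab2 S)
  let ?F = "{{u, v} |u v. u \<in> V1 \<and> v \<in> V2 \<and> (lab1 u, lab2 v) \<in> S}"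
  let ?lab = "\<lambda>w. if w \<in> V1 then lab1 w else lab2 w"
  have wf: "finite V1" "E1 \<subseteq> nsets V1 2" "lab1 ` V1 \<subseteq> {1..k}"
    "finite V2" "E2 \<subseteq> nsets V2 2" "lab2 ` V2 \<subseteq> {1..k}"
    using nlc_built_wellformed join.hyps(1,2) by blast+
  have F: "{u, v} \<in> ?F \<longleftrightarrow> (lab1 u, lab2 v) \<in> S" if "u \<in> V1" "v \<in> V2" for u v
    using that join.hyps(3) by (auto simp: doubleton_eq_iff)
  have F': "{u, v} \<notin> ?F" if "{u, v} \<subseteq> V1 \<or> {u, v} \<subseteq> V2" for u v
    using that join.hyps(3) by (auto simp: doubleton_eq_iff)
  consider "card (V1 \<union> V2) < 2 * m" | "m \<le> card V1" | "m \<le> card V2"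
    using card_Un_disjoint[OF wf(1,4) join.hyps(3)] by linarith
  then show ?case
  proof cases
    case 1
    then show ?thesis
      using join.prems wf
      by (intro exI[of _ "V1 \<union> V2"] exI[of _ ?lab]) (auto simp: twin_cut_def)
  next
    case 2
    with join.IH(1) join.prems obtain A f where A: "A \<subseteq> V1" "m \<le> card A" "card A < 2 * m"
      "f ` A \<subseteq> {1..k}" "\<forall>u\<in>A. \<forall>u'\<in>A. f u = f u' \<longrightarrow> lab1 u = lab1 u'" "twin_cut V1 E1 A f"
      by blast
    have "twin_cut (V1 \<union> V2) (E1 \<union> E2 \<union> ?F) A f"
    proof (rule twin_cut_join[OF join.hyps(3) wf(2) wf(5) A(1) A(6)])
      show "lab1 u = lab1 u'" if "u \<in> A" "u' \<in> A" "f u = f u'" for u u'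
        using A(5) that by blast
      show "{u, v} \<in> ?F \<longleftrightarrow> (lab1 u, lab2 v) \<in> S" if "u \<in> V1" "v \<in> V2" for u v
        using F that by blast
      show "{u, v} \<notin> ?F" if "u \<in> V1" "v \<in> V1" for u v
        using F'[of u v] that by simp
    qed
    moreover have "?lab u = lab1 u" if "u \<in> A" for u
      using A(1) that by auto
    then have "\<forall>u\<in>A. \<forall>u'\<in>A. f u = f u' \<longrightarrow> ?lab u = ?lab u'"
      using A(5) by metis
    ultimately show ?thesis
      using A(1-4) by blast
  next
    case 3
    with join.IH(2) join.prems obtain A f where A: "A \<subseteq> V2" "m \<le> card A" "card A < 2 * m"
      "f ` A \<subseteq> {1..k}" "\<forall>u\<in>A. \<forall>u'\<in>A. f u = f u' \<longrightarrow> lab2 u = lab2 u'" "twin_cut V2 E2 A f"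
      by blast
    have "twin_cut (V2 \<union> V1) (E2 \<union> E1 \<union> ?F) A f"
    proof (rule twin_cut_join[OF _ wf(5) wf(2) A(1) A(6)])
      show "V2 \<inter> V1 = {}"
        using join.hyps(3) by blast
      show "lab2 u = lab2 u'" if "u \<in> A" "u' \<in> A" "f u = f u'" for u u'
        using A(5) that by blast
      show "{u, v} \<in> ?F \<longleftrightarrow> (lab1 v, lab2 u) \<in> S" if "u \<in> V2" "v \<in> V1" for u v
        using F[of v u] that by (simp add: insert_commute)
      show "{u, v} \<notin> ?F" if "u \<in> V2" "v \<in> V2" for u v
        using F'[of u v] that by simp
    qed
    then have "twin_cut (V1 \<union> V2) (E1 \<union> E2 \<union> ?F) A f"
      by (simp add: Un_commute)
    moreover have "?lab u = lab2 u" if "u \<in> A" for u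
      using A(1) join.hyps(3) that by auto
    then have "\<forall>u\<in>A. \<forall>u'\<in>A. f u = f u' \<longrightarrow> ?lab u = ?lab u'"
      using A(5) by metis
    ultimately show ?thesis
      using A(1-4) by blast
  qed
next
  case (relabel V E lab R)
  then obtain A f where A: "A \<subseteq> V" "m \<le> card A" "card A < 2 * m" "f ` A \<subseteq> {1..k}"
    "\<forall>u\<in>A. \<forall>u'\<in>A. f u = f u' \<longrightarrow> lab u = lab u'" "twin_cut V E A f"
    by blast
  have "\<forall>u\<in>A. \<forall>u'\<in>A. f u = f u' \<longrightarrow> (R \<circ> lab) u = (R \<circ> lab) u'"
    using A(5) unfolding comp_def by (intro ballI impI arg_cong[of _ _ R]) blast
  with A show ?case
    by blast
qed

corollary nlc_built_balanced_cut:
  assumes "nlc_built k V E lab" "0 < m" "m \<le> card V"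
  obtains A f where "A \<subseteq> V" "m \<le> card A" "card A < 2 * m" "f \<in> A \<rightarrow>\<^sub>E {1..k}" "twin_cut V E A f"
proof -
  from nlc_built_balanced_cut_refining[OF assms] obtain A f where
    A: "A \<subseteq> V" "m \<le> card A" "card A < 2 * m" "f ` A \<subseteq> {1..k}" "twin_cut V E A f"
    by blast
  have "twin_cut V E A (restrict f A) \<longleftrightarrow> twin_cut V E A f"
    by (simp add: twin_cut_def)
  moreover have "restrict f A \<in> A \<rightarrow>\<^sub>E {1..k}"
    using A(4) by (auto simp: restrict_def)
  ultimately show thesis
    using A(1-3,5) by (intro that[of A "restrict f A"]) simp_all
qed

section \<open>Counting graphs with a prescribed cut\<close>

text \<open>
  Such a graph is determined by its edges outside the set \<open>D\<close> of pairs that join a vertex of \<open>A\<close>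
  that does not represent its class to a vertex outside \<open>A\<close>: adjacency on a pair in \<open>D\<close> is read
  off at the representative. The exponent is a lower bound for \<open>card D\<close>.
\<close>

lemma card_twin_cut_graphs:
  fixes f :: "'a \<Rightarrow> 'b"
  assumes "finite V" "A \<subseteq> V" "card (f ` A) \<le> k"
  shows "card {E \<in> Pow (nsets V 2). twin_cut V E A f}
           * 2 ^ ((card A - k) * (card V - card A)) \<le> card (Pow (nsets V 2))"
proof -
  let ?N = "nsets V 2"
  define r where "r u = inv_into A f (f u)" for u
  have r: "r u \<in> A" "f (r u) = f u" "r (r u) = r u" if "u \<in> A" for u
    using that by (auto simp: r_def inv_into_into f_inv_into_f)
  have [simp]: "finite A" "finite ?N"
    using assms by (auto intro: finite_subset finite_imp_finite_nsets)
  \<comment> \<open>The pairs whose adjacency is copied from a representative.\<close>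
  define D where "D = (\<lambda>(u, v). {u, v}) ` ((A - r ` A) \<times> (V - A))"
  have D: "D \<subseteq> ?N"
    using assms(2) by (auto simp: D_def)
  have "card (r ` A) \<le> card (f ` A)"
  proof -
    have "r ` A = inv_into A f ` f ` A" by (auto simp: r_def)
    then show ?thesis by (simp add: card_image_le)
  qed
  then have "card A - k \<le> card (A - r ` A)"
    using r assms(3) by (subst card_Diff_subset) auto
  moreover have "inj_on (\<lambda>(u, v). {u, v}) ((A - r ` A) \<times> (V - A))"
    by (auto simp: inj_on_def doubleton_eq_iff)
  then have "card D = card (A - r ` A) * (card V - card A)"
    unfolding D_def using assms by (subst card_image) (auto simp: card_Diff_subset)
  ultimately have cD: "(card A - k) * (card V - card A) \<le> card D"
    by simp
  have "inj_on (\<lambda>E. E - D) {E \<in> Pow ?N. twin_cut V E A f}"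
  proof (rule inj_onI, clarify)
    fix E E'
    assume *: "twin_cut V E A f" "twin_cut V E' A f" "E - D = E' - D"
    have "e \<in> E \<longleftrightarrow> e \<in> E'" for e
    proof (cases "e \<in> D")
      case True
      then obtain u v where e: "e = {u, v}" "u \<in> A" "v \<in> V - A"
        by (auto simp: D_def)
      then have "{r u, v} \<notin> D"
        using r by (auto simp: D_def doubleton_eq_iff)
      moreover have "e \<in> E \<longleftrightarrow> {r u, v} \<in> E" "e \<in> E' \<longleftrightarrow> {r u, v} \<in> E'"
        using *(1,2) e r unfolding twin_cut_def by metis+
      ultimately show ?thesis
        using *(3) by blast
    qed (use *(3) in blast)
    then show "E = E'" by blast
  qed
  then have "card {E \<in> Pow ?N. twin_cut V E A f} \<le> card (Pow (?N - D))"
    by (rule card_inj_on_le) auto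
  also have "\<dots> = 2 ^ (card ?N - card D)"
    using D by (simp add: card_Pow card_Diff_subset finite_subset)
  finally have "card {E \<in> Pow ?N. twin_cut V E A f} * 2 ^ ((card A - k) * (card V - card A))
      \<le> 2 ^ (card ?N - card D) * 2 ^ card D"
    using cD by (intro mult_mono power_increasing) auto
  also have "\<dots> = 2 ^ card ?N"
    using card_mono[OF _ D] by (simp flip: power_add)
  finally show ?thesis
    by (simp add: card_Pow)
qed

section \<open>Linear lower bound\<close>

text \<open>
  A union bound over all pairs of a set \<open>A\<close> and a labelling of \<open>A\<close>. The exponent \<open>n\<^sup>2 / 72\<close> is the
  product of \<open>n / 12\<close>, a lower bound for \<open>card A - k\<close>, and \<open>n / 6\<close>, one for \<open>n - card A\<close>. The
  condition \<open>n \<ge> 3\<close> keeps \<open>n div 3\<close> positive and at least \<open>n / 6\<close>.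
\<close>

lemma card_small_width_graphs:
  assumes "n \<ge> 3"
  shows "real (card {E \<in> Pow (nsets {..<n} 2). real (nlc_width {..<n} E) < real n / 12})
    \<le> (2 * real n) ^ n * 2 powr (- (real n)\<^sup>2 / 72) * real (card (Pow (nsets {..<n} 2)))"
    (is "real (card ?B) \<le> _ * real (card (Pow ?N))")
proof -
  define m where "m = n div 3"
  define k where "k = n div 12"
  define I where "I = {(A, f). A \<subseteq> {..<n} \<and> m \<le> card A \<and> card A < 2 * m \<and> f \<in> A \<rightarrow>\<^sub>E {1..k}}"
  define T where "T = (\<lambda>(A, f :: nat \<Rightarrow> nat). {E \<in> Pow ?N. twin_cut {..<n} E A f})"
  let ?J = "SIGMA A:Pow {..<n}. A \<rightarrow>\<^sub>E {1..k}"
  have fin_fun: "finite (A \<rightarrow>\<^sub>E {1..k})" if "A \<in> Pow {..<n}" for A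
    using that by (intro finite_PiE) (auto intro: finite_subset)
  have IJ: "I \<subseteq> ?J" and finJ: "finite ?J"
    using fin_fun by (auto simp: I_def)
  have finI: "finite I"
    using IJ finJ by (rule finite_subset)
  have "card ?J = (\<Sum>A\<in>Pow {..<n}. card (A \<rightarrow>\<^sub>E {1..k}))"
    using fin_fun by (subst card_SigmaI) auto
  also have "\<dots> \<le> (\<Sum>A\<in>Pow {..<n}. n ^ n)"
  proof (rule sum_mono)
    fix A assume A: "A \<in> Pow {..<n}"
    then have "card A \<le> n" "finite A"
      using card_mono[of "{..<n}" A] by (auto intro: finite_subset)
    then have "card (A \<rightarrow>\<^sub>E {1..k}) = k ^ card A"
      by (simp add: card_PiE)
    also have "\<dots> \<le> n ^ card A"
      by (intro power_mono) (auto simp: k_def)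
    also have "\<dots> \<le> n ^ n"
      using \<open>card A \<le> n\<close> assms by (intro power_increasing) auto
    finally show "card (A \<rightarrow>\<^sub>E {1..k}) \<le> n ^ n" .
  qed
  also have "\<dots> = (2 * n) ^ n"
    by (simp add: card_Pow power_mult_distrib)
  finally have cardI: "card I \<le> (2 * n) ^ n"
    using card_mono[OF finJ IJ] by linarith
  have "?B \<subseteq> (\<Union>i\<in>I. T i)"
  proof
    fix E assume E: "E \<in> ?B"
    then obtain lab where "nlc_built (nlc_width {..<n} E) {..<n} E lab"
      using nlc_width_le(2)[of n E] assms by auto
    moreover have "0 < m" "m \<le> card {..<n}"
      using assms by (simp_all add: m_def div_greater_zero_iff)
    ultimately obtain A f where A: "A \<subseteq> {..<n}" "m \<le> card A" "card A < 2 * m"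
      "f \<in> A \<rightarrow>\<^sub>E {1..nlc_width {..<n} E}" "twin_cut {..<n} E A f"
      by (rule nlc_built_balanced_cut)
    have "nlc_width {..<n} E \<le> k"
      using E by (auto simp: k_def less_eq_div_iff_mult_less_eq)
    then have "A \<rightarrow>\<^sub>E {1..nlc_width {..<n} E} \<subseteq> A \<rightarrow>\<^sub>E {1..k}"
      by (intro PiE_mono) simp
    with A(4) have "f \<in> A \<rightarrow>\<^sub>E {1..k}"
      by blast
    with A E have "(A, f) \<in> I" "E \<in> T (A, f)"
      by (simp_all add: I_def T_def)
    then show "E \<in> (\<Union>i\<in>I. T i)"
      by blast
  qed
  then have "card ?B \<le> card (\<Union>i\<in>I. T i)"
    using finI by (intro card_mono) (auto simp: T_def finite_imp_finite_nsets)
  also have "\<dots> \<le> (\<Sum>i\<in>I. card (T i))"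
    using finI by (rule card_UN_le)
  finally have "real (card ?B) \<le> (\<Sum>i\<in>I. real (card (T i)))"
    unfolding of_nat_sum[symmetric] of_nat_le_iff .
  also have "\<dots> \<le> (\<Sum>i\<in>I. 2 powr (- (real n)\<^sup>2 / 72) * real (card (Pow ?N)))"
  proof (rule sum_mono)
    fix i assume "i \<in> I"
    then obtain A f where i: "i = (A, f)" "A \<subseteq> {..<n}" "m \<le> card A" "card A < 2 * m"
      "f \<in> A \<rightarrow>\<^sub>E {1..k}"
      by (auto simp: I_def)
    let ?d = "(card A - k) * (n - card A)"
    have "card (f ` A) \<le> card {1..k}"
      using i(5) by (intro card_mono) auto
    with i have "card (T i) * 2 ^ ?d \<le> card (Pow ?N)"
      using card_twin_cut_graphs[of "{..<n}" A f k] by (simp add: T_def)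
    then have "real (card (T i) * 2 ^ ?d) \<le> real (card (Pow ?N))"
      by (rule of_nat_mono)
    then have T: "real (card (T i)) * 2 powr real ?d \<le> real (card (Pow ?N))"
      by (simp only: powr_realpow[OF zero_less_numeral] of_nat_mult[of "card (T i)"]
          of_nat_power of_nat_numeral)
    \<comment> \<open>For \<open>n \<ge> 3\<close>, rounding in \<open>n div 3\<close> costs at most a factor \<open>2\<close>.\<close>
    have "n \<le> 6 * m" "12 * k \<le> n" "3 * m \<le> n"
      using assms unfolding m_def k_def by presburger+
    with i have "n \<le> 12 * (card A - k)" "n \<le> 6 * (n - card A)"
      by linarith+
    then have "n * n \<le> (12 * (card A - k)) * (6 * (n - card A))"
      by (rule mult_le_mono)
    then have "n * n \<le> 72 * ?d"
      by (simp add: algebra_simps)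
    then have "real (n * n) \<le> real (72 * ?d)"
      by (rule of_nat_mono)
    then have "(real n)\<^sup>2 / 72 \<le> real ?d"
      by (simp add: power2_eq_square)
    then have "real (card (T i)) * 2 powr ((real n)\<^sup>2 / 72) \<le> real (card (T i)) * 2 powr real ?d"
      by (intro mult_left_mono powr_mono) auto
    also note T
    finally show "real (card (T i)) \<le> 2 powr (- (real n)\<^sup>2 / 72) * real (card (Pow ?N))"
      by (simp add: powr_minus field_simps)
  qed
  also have "\<dots> = real (card I) * (2 powr (- (real n)\<^sup>2 / 72) * real (card (Pow ?N)))"
    by simp
  also have "\<dots> \<le> real ((2 * n) ^ n) * (2 powr (- (real n)\<^sup>2 / 72) * real (card (Pow ?N)))"
    using cardI by (intro mult_right_mono of_nat_mono) auto
  finally show ?thesis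
    by (simp add: mult.assoc)
qed

text \<open>At edge probability \<open>1/2\<close> all graphs are equally likely, so probabilities are counts.\<close>

lemma random_graph_half: "random_graph n (1/2) = pmf_of_set (Pow (nsets {..<n} 2))"
  unfolding random_graph_def
  by (rule pmf_of_set_Pow_conv_bernoulli) (simp add: finite_imp_finite_nsets)

lemma prob_random_graph_half:
  "measure_pmf.prob (random_graph n (1/2)) X =
     card {E \<in> Pow (nsets {..<n} 2). E \<in> X} / card (Pow (nsets {..<n} 2))"
proof -
  have "Pow (nsets {..<n} 2) \<inter> X = {E \<in> Pow (nsets {..<n} 2). E \<in> X}"
    by auto
  then show ?thesis
    unfolding random_graph_half
    by (subst measure_pmf_of_set) (auto simp: finite_imp_finite_nsets)
qed

theorem corollary5:
  shows "\<exists>c C :: real. 0 < c \<and> c \<le> C \<and>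
    (\<lambda>n. measure_pmf.prob (random_graph n (1/2))
           {E. c * real n \<le> real (nlc_width {..<n} E) \<and>
               real (nlc_width {..<n} E) \<le> C * real n}) \<longlonglongrightarrow> 1"
proof (rule exI[of _ "1/12"], rule exI[of _ 1], intro conjI)
  let ?P = "\<lambda>n. measure_pmf.prob (random_graph n (1/2))"
  let ?G = "\<lambda>n. {E. 1/12 * real n \<le> real (nlc_width {..<n} E) \<and>
               real (nlc_width {..<n} E) \<le> 1 * real n}"
  have "1 - (2 * real n) ^ n * 2 powr (- (real n)\<^sup>2 / 72) \<le> ?P n (?G n)" if n: "n \<ge> 3" for n
  proof -
    let ?N = "nsets {..<n} 2"
    have pos: "real (card (Pow ?N)) > 0"
      by (simp add: card_Pow finite_imp_finite_nsets)
    have "{E \<in> Pow ?N. E \<in> - ?G n} = {E \<in> Pow ?N. real (nlc_width {..<n} E) < real n / 12}"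
      using nlc_width_le(1)[of n] n by fastforce
    then have "?P n (- ?G n) \<le> (2 * real n) ^ n * 2 powr (- (real n)\<^sup>2 / 72)"
      using card_small_width_graphs[OF n] pos
      by (simp add: prob_random_graph_half pos_divide_le_eq)
    moreover have "?P n (- ?G n) = 1 - ?P n (?G n)"
      using measure_pmf.prob_compl[of "?G n" "random_graph n (1/2)"] by (simp add: Compl_eq_Diff_UNIV)
    ultimately show ?thesis by linarith
  qed
  then have lower: "\<forall>\<^sub>F n in sequentially.
      1 - (2 * real n) ^ n * 2 powr (- (real n)\<^sup>2 / 72) \<le> ?P n (?G n)"
    by (rule eventually_sequentiallyI)
  have upper: "\<forall>\<^sub>F n in sequentially. ?P n (?G n) \<le> 1"
    by simp
  have "(\<lambda>n. 1 - (2 * real n) ^ n * 2 powr (- (real n)\<^sup>2 / 72)) \<longlonglongrightarrow> 1"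
    by real_asymp
  then show "(\<lambda>n. ?P n (?G n)) \<longlonglongrightarrow> 1"
    by (rule tendsto_sandwich[OF lower upper _ tendsto_const])
qed simp_all

end
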